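(* For every graph $H\in\mathcal{G}\cup\mathcal{H}$ there is a constant $c=c(H)>0$, not depending on $n$, $m$ or $k$, such that for all positive integers $m,k$ and all $n$ sufficiently large compared with $m$ and $k$, every rainbow $(P_3\cup H)$-free coloring of $K_n$ using all the $m$ colors contains a $k$-connected monochromatic subgraph of order at least $cn$.
   Context: All graphs are finite and simple; the order of a graph is its number of vertices. $P_n$ is the path on $n$ vertices and $G\cup H$ denotes the disjoint union. An edge-coloring of $K_n$ "using all the $m$ colors" is a surjective map $c:E(K_n)\to\{1,\dots,m\}$. A colored graph is rainbow if all its edges have different colors, and monochromatic if all its edges have the same color. A coloring is rainbow $H$-free if it contains no rainbow subgraph isomorphic to $H$. Say that a graph $G$ without isolated vertices, of order at least $3$, is good if, for positive integers $n\gg m\gg k$ (with $m\ge|E(G)|$), every rainbow $G$-free coloring of $K_n$ using all the $m$ colors contains a $k$-connected monochromatic subgraph of order at least $n-f$, where $f$ does not depend on $n$. Explicitly: for every $k\ge1$ there is $m_0$ such that for every $m\ge\max\{m_0,|E(G)|\}$ there are $n_0$ and a constant $f$ such that for every $n\ge n_0$, every rainbow $G$-free coloring of $K_n$ using all the $m$ colors contains a $k$-connected monochromatic subgraph of order at least $n-f$. $\mathcal{G}$ is the set of connected good graphs and $\mathcal{H}$ is the set of disconnected good graphs. *)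

theory Defs
  imports Complex_Main
begin

datatype 'a graph = Graph (verts: "'a set") (edges: "'a set set")

definition simple_graph :: "'a graph \<Rightarrow> bool" where
  "simple_graph G \<longleftrightarrow>
     finite (verts G) \<and> (\<forall>e \<in> edges G. e \<subseteq> verts G \<and> card e = 2)"

definition graph_order :: "'a graph \<Rightarrow> nat" where
  "graph_order G = card (verts G)"

definition no_isolated_vertices :: "'a graph \<Rightarrow> bool" where
  "no_isolated_vertices G \<longleftrightarrow> (\<forall>v \<in> verts G. \<exists>e \<in> edges G. v \<in> e)"

definition complete_graph :: "nat \<Rightarrow> nat graph" where
  "complete_graph n = Graph {1..n} {e. e \<subseteq> {1..n} \<and> card e = 2}"

definition path_graph :: "nat \<Rightarrow> nat graph" where
  "path_graph n = Graph {1..n} {{i, i + 1} | i. 1 \<le> i \<and> i < n}"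

definition disjoint_union :: "'a graph \<Rightarrow> 'b graph \<Rightarrow> ('a + 'b) graph" where
  "disjoint_union G H =
     Graph (verts G <+> verts H) ((`) Inl ` edges G \<union> (`) Inr ` edges H)"

definition subgraph_of :: "'a graph \<Rightarrow> 'a graph \<Rightarrow> bool" where
  "subgraph_of S G \<longleftrightarrow> simple_graph S \<and> verts S \<subseteq> verts G \<and> edges S \<subseteq> edges G"

definition isomorphic_graphs :: "'a graph \<Rightarrow> 'b graph \<Rightarrow> bool" where
  "isomorphic_graphs G H \<longleftrightarrow>
     (\<exists>f. bij_betw f (verts G) (verts H) \<and> edges H = (`) f ` edges G)"

definition connected_graph :: "'a graph \<Rightarrow> bool" where
  "connected_graph G \<longleftrightarrow> verts G \<noteq> {} \<and>
     (\<forall>u \<in> verts G. \<forall>v \<in> verts G. (u, v) \<in> {(x, y). {x, y} \<in> edges G}\<^sup>*)"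

definition delete_verts :: "'a graph \<Rightarrow> 'a set \<Rightarrow> 'a graph" where
  "delete_verts G X = Graph (verts G - X) {e \<in> edges G. e \<inter> X = {}}"

text \<open>The usual convention is adopted that a \<open>k\<close>-connected graph has more than \<open>k\<close> vertices.\<close>

definition k_connected :: "nat \<Rightarrow> 'a graph \<Rightarrow> bool" where
  "k_connected k G \<longleftrightarrow> k < graph_order G \<and>
     (\<forall>X \<subseteq> verts G. card X < k \<longrightarrow> connected_graph (delete_verts G X))"

text \<open>A coloring is a function on all sets of naturals; only its values on the edges of the
  complete graph are ever used.\<close>

definition coloring_using_all :: "nat \<Rightarrow> nat \<Rightarrow> (nat set \<Rightarrow> nat) \<Rightarrow> bool" where
  "coloring_using_all n m col \<longleftrightarrow> col ` edges (complete_graph n) = {1..m}"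

definition rainbow :: "('a set \<Rightarrow> nat) \<Rightarrow> 'a graph \<Rightarrow> bool" where
  "rainbow col S \<longleftrightarrow> inj_on col (edges S)"

definition monochromatic :: "('a set \<Rightarrow> nat) \<Rightarrow> 'a graph \<Rightarrow> bool" where
  "monochromatic col S \<longleftrightarrow> (\<forall>e \<in> edges S. \<forall>e' \<in> edges S. col e = col e')"

definition rainbow_free :: "nat \<Rightarrow> (nat set \<Rightarrow> nat) \<Rightarrow> 'a graph \<Rightarrow> bool" where
  "rainbow_free n col H \<longleftrightarrow>
     \<not> (\<exists>S. subgraph_of S (complete_graph n) \<and> isomorphic_graphs S H \<and> rainbow col S)"

text \<open>In the last line, \<open>n \<le> graph_order S + f\<close> says that the order is at least \<open>n - f\<close>.\<close>

definition good_graph :: "'a graph \<Rightarrow> bool" where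
  "good_graph G \<longleftrightarrow>
     simple_graph G \<and> no_isolated_vertices G \<and> 3 \<le> graph_order G \<and>
     (\<forall>k\<ge>1. \<exists>m0. \<forall>m \<ge> max m0 (card (edges G)). \<exists>n0 f. \<forall>n\<ge>n0. \<forall>col.
        coloring_using_all n m col \<and> rainbow_free n col G \<longrightarrow>
        (\<exists>S. subgraph_of S (complete_graph n) \<and> monochromatic col S \<and>
             k_connected k S \<and> n \<le> graph_order S + f))"

definition connected_good_graphs :: "'a graph set" where
  "connected_good_graphs = {G. good_graph G \<and> connected_graph G}"

definition disconnected_good_graphs :: "'a graph set" where
  "disconnected_good_graphs = {G. good_graph G \<and> \<not> connected_graph G}"

end

theory Submission
  imports Defs "HOL-Library.FuncSet"
begin

text \<open>
  The linear bound holds for every finite simple graph \<open>F\<close>, and the theorem is the case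
  \<open>F = P\<^sub>3 \<union> H\<close>. Let \<open>t\<close> be the order of \<open>F\<close> and suppose that no color
  contains a \<open>k\<close>-connected subgraph of order at least \<open>s\<close>, where \<open>s\<close> is about
  \<open>n / (8 t^4)\<close>. The point is that a coloring whose highly connected monochromatic pieces are all
  this small looks locally like a random coloring with many colors, so that a typical choice of
  \<open>t\<close> vertices spans a rainbow complete graph.

  To see this, cut each color class repeatedly along separators with fewer than \<open>k\<close> vertices until
  all pieces have fewer than \<open>s\<close> vertices. If the edges from the separator to the smaller
  side are discarded at each step, only \<open>O(k n^2 / s)\<close> edges, that is \<open>O(k n)\<close>, are
  discarded per color (\<open>low_cut_partition\<close>). The discarded edges of all
  \<open>m\<close> colors together leave all but a bounded number of vertices with at most \<open>s\<close>
  discarded edges; ignore the exceptional vertices. This is where \<open>n\<close> must be large compared with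
  \<open>m\<close> and \<open>k\<close>, while \<open>s\<close> depends on \<open>n\<close> and \<open>t\<close> only.

  Now place the vertices of \<open>F\<close> arbitrarily. If two edges of the image have the same color
  \<open>i\<close>, then one of them has an end \<open>x\<close> outside the other edge, and either this
  edge was discarded or its other end lies in the same piece of color \<open>i\<close> as
  \<open>x\<close>. Once the other vertices are placed, each of these events is caused by at most
  \<open>s\<close> positions of \<open>x\<close>, because the color \<open>i\<close> can be read off the edge avoiding
  \<open>x\<close>. There are at most \<open>t^4\<close> such situations, so by the union bound
  (\<open>map_avoiding_rare_events\<close>) some placement is injective and rainbow
  (\<open>rainbow_copy_from_partitions\<close>). Hence a rainbow \<open>F\<close>-free coloring has a
  \<open>k\<close>-connected monochromatic subgraph of order at least \<open>s\<close>.
\<close>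

section \<open>Cutting a graph without large highly connected subgraphs\<close>

definition induced :: "'a set set \<Rightarrow> 'a set \<Rightarrow> 'a graph" where
  "induced E U = Graph U {e \<in> E. e \<subseteq> U}"

text \<open>Ordered pairs are used so that counting by the first entry gives degrees; each edge is
  counted twice.\<close>

definition crossing_pairs :: "'a set set \<Rightarrow> 'a set \<Rightarrow> ('a \<Rightarrow> 'b) \<Rightarrow> ('a \<times> 'a) set" where
  "crossing_pairs E W p = {(u, v). u \<in> W \<and> v \<in> W \<and> {u, v} \<in> E \<and> p u \<noteq> p v}"

lemma finite_crossing_pairs: "finite W \<Longrightarrow> finite (crossing_pairs E W p)"
  by (rule finite_subset[of _ "W \<times> W"]) (auto simp: crossing_pairs_def)

text \<open>Choosing the side \<open>A\<close> of the separation to be the smaller one makes the number of edges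
  between \<open>A\<close> and the separator \<open>X\<close> affordable: it is less than
  \<open>k\<close> times the order of the smaller part of the partition into \<open>A\<close> and \<open>W - A\<close>.\<close>

lemma not_k_connected_separation:
  assumes fin: "finite W" and large: "k < card W" and nk: "\<not> k_connected k (induced E W)"
  obtains A X where "A \<subseteq> W" "X \<subseteq> W" "A \<inter> X = {}" "A \<noteq> {}" "card X < k"
    "2 * card A \<le> card W"
    "\<And>u v. u \<in> A \<Longrightarrow> v \<in> W - X - A \<Longrightarrow> {u, v} \<notin> E"
proof -
  from nk large obtain X where X: "X \<subseteq> W" "card X < k"
    and dis: "\<not> connected_graph (delete_verts (induced E W) X)"
    by (auto simp: k_connected_def induced_def graph_order_def)
  define R where "R = {(x, y). {x, y} \<in> E \<and> {x, y} \<subseteq> W \<and> {x, y} \<inter> X = {}}"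
  have "W - X \<noteq> {}"
  proof
    assume "W - X = {}"
    then have "W = X" using X(1) by blast
    then show False using X(2) large by simp
  qed
  then obtain u v where uv: "u \<in> W - X" "v \<in> W - X" "(u, v) \<notin> R\<^sup>*"
    using dis by (auto simp: connected_graph_def delete_verts_def induced_def R_def)
  define A where "A = {w \<in> W - X. (u, w) \<in> R\<^sup>*}"
  define B where "B = W - X - A"
  have AB: "A \<noteq> {}" "B \<noteq> {}" using uv by (auto simp: A_def B_def)
  have sep: "{x, y} \<notin> E" if "x \<in> A" "y \<in> B" for x y
  proof
    assume "{x, y} \<in> E"
    then have "(x, y) \<in> R" using that by (auto simp: R_def A_def B_def)
    then have "y \<in> A" using that by (auto simp: A_def B_def intro: rtrancl_into_rtrancl)
    then show False using that by (auto simp: B_def)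
  qed
  have "card A + card B = card (A \<union> B)"
    using fin by (intro card_Un_disjoint[symmetric]) (auto simp: A_def B_def)
  also have "\<dots> \<le> card W" using fin by (intro card_mono) (auto simp: A_def B_def)
  finally have cards: "card A + card B \<le> card W" .
  have BA: "W - X - B = A" by (auto simp: A_def B_def)
  show thesis
  proof (cases "card A \<le> card B")
    case True
    show thesis
      by (rule that[of A X]) (use X AB cards True sep in \<open>auto simp: A_def B_def\<close>)
  next
    case False
    have "{x, y} \<notin> E" if "x \<in> B" "y \<in> W - X - B" for x y
      using sep[of y x] that BA by (simp add: insert_commute)
    then show thesis
      by (intro that[of B X]) (use X AB cards False in \<open>auto simp: B_def\<close>)
  qed
qed

text \<open>
  The pieces are the fibres of \<open>p\<close>. As long as \<open>W\<close> has at least \<open>s\<close> vertices,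
  it has a small separator \<open>X\<close>; split off a side \<open>A\<close> and leave \<open>X\<close> with the rest.
  With \<open>a\<close> and \<open>b\<close> the orders of the two parts, this costs at most \<open>2 k a\<close> ordered
  pairs, and the bound \<open>2 k w^2 / s\<close> for \<open>w\<close> vertices survives since
  \<open>(a + b)^2 - a^2 - b^2 = 2 a b\<close> is at least \<open>a s\<close>. The condition
  \<open>p ` W \<subseteq> W\<close> keeps the fibres of the two parts disjoint when their labellings are glued.
\<close>

lemma low_cut_partition:
  assumes "finite W" "k < s"
    and "\<And>U. U \<subseteq> W \<Longrightarrow> s \<le> card U \<Longrightarrow> \<not> k_connected k (induced E U)"
  shows "\<exists>p. p ` W \<subseteq> W \<and> (\<forall>u\<in>W. card {v \<in> W. p v = p u} < s) \<and>
    s * card (crossing_pairs E W p) \<le> 2 * k * (card W)\<^sup>2"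
  using assms
proof (induction "card W" arbitrary: W rule: less_induct)
  case less
  note fin = less.prems(1)
  show ?case
  proof (cases "card W < s")
    case True
    show ?thesis
    proof (cases "W = {}")
      case True
      then show ?thesis by (auto simp: crossing_pairs_def)
    next
      case False
      then obtain w where "w \<in> W" by blast
      with True show ?thesis
        by (intro exI[of _ "\<lambda>_. w"]) (auto simp: crossing_pairs_def)
    qed
  next
    case False
    then have sW: "s \<le> card W" by simp
    have "\<not> k_connected k (induced E W)" using less.prems(3) sW by simp
    moreover have "k < card W" using sW less.prems(2) by simp
    ultimately obtain A X where AX: "A \<subseteq> W" "X \<subseteq> W" "A \<inter> X = {}" "A \<noteq> {}" "card X < k"
      "2 * card A \<le> card W"
      and sep: "\<And>u v. u \<in> A \<Longrightarrow> v \<in> W - X - A \<Longrightarrow> {u, v} \<notin> E"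
      using not_k_connected_separation[OF fin] by metis
    define B where "B = W - A"
    have fAB: "finite A" "finite B" "finite X" using fin AX by (auto simp: B_def intro: finite_subset)
    have W: "card W = card A + card B"
      using card_Un_disjoint[of A B] fAB AX(1) by (auto simp: B_def Un_absorb1)
    have "card A > 0" using AX(4) fAB by (simp add: card_gt_0_iff)
    then have lt: "card A < card W" "card B < card W" using W AX(6) by auto
    have piece: "\<exists>p. p ` U \<subseteq> U \<and> (\<forall>u\<in>U. card {v \<in> U. p v = p u} < s) \<and>
        s * card (crossing_pairs E U p) \<le> 2 * k * (card U)\<^sup>2"
      if "U \<subseteq> W" "card U < card W" for U
    proof (rule less.hyps[OF that(2) _ less.prems(2)])
      show "finite U" using that(1) fin by (rule finite_subset)
      show "\<not> k_connected k (induced E U')" if "U' \<subseteq> U" "s \<le> card U'" for U'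
        using less.prems(3)[OF _ that(2)] that(1) \<open>U \<subseteq> W\<close> by blast
    qed
    obtain p where p: "p ` A \<subseteq> A" "\<forall>u\<in>A. card {v \<in> A. p v = p u} < s"
      "s * card (crossing_pairs E A p) \<le> 2 * k * (card A)\<^sup>2"
      using piece[OF AX(1) lt(1)] by blast
    have "B \<subseteq> W" by (auto simp: B_def)
    from piece[OF this lt(2)] obtain q where q: "q ` B \<subseteq> B" "\<forall>u\<in>B. card {v \<in> B. q v = q u} < s"
      "s * card (crossing_pairs E B q) \<le> 2 * k * (card B)\<^sup>2"
      by blast
    define r where "r u = (if u \<in> A then p u else q u)" for u
    have in_A: "r u \<in> A" if "u \<in> A" for u using p(1) that by (auto simp: r_def)
    have in_B: "r u \<in> B" if "u \<in> B" for u using q(1) that by (auto simp: r_def B_def)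
    have rW: "r ` W \<subseteq> W" using in_A in_B AX(1) by (auto simp: B_def)
    have cl: "card {v \<in> W. r v = r u} < s" if "u \<in> W" for u
    proof (cases "u \<in> A")
      case True
      have "r v \<noteq> r u" if "v \<in> B" for v
        using in_A[OF True] in_B[OF that] by (auto simp: B_def)
      then have "{v \<in> W. r v = r u} = {v \<in> A. p v = p u}"
        using True AX(1) by (auto simp: B_def) (auto simp: r_def split: if_splits)
      then show ?thesis using p(2) True by simp
    next
      case False
      then have uB: "u \<in> B" using that by (auto simp: B_def)
      have "r v \<noteq> r u" if "v \<in> A" for v
        using in_A[OF that] in_B[OF uB] by (auto simp: B_def)
      then have "{v \<in> W. r v = r u} = {v \<in> B. q v = q u}"
        using False AX(1) by (auto simp: B_def) (auto simp: r_def split: if_splits)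
      then show ?thesis using q(2) uB by simp
    qed
    have "crossing_pairs E W r \<subseteq>
        (crossing_pairs E A p \<union> crossing_pairs E B q) \<union> (A \<times> X \<union> X \<times> A)"
    proof
      fix e assume "e \<in> crossing_pairs E W r"
      then obtain u v where e: "e = (u, v)" "u \<in> W" "v \<in> W" "{u, v} \<in> E" "r u \<noteq> r v"
        by (auto simp: crossing_pairs_def)
      have "v \<in> X" if "u \<in> A" "v \<notin> A" using sep[of u v] that e by blast
      moreover have "u \<in> X" if "v \<in> A" "u \<notin> A"
        using sep[of v u] that e by (auto simp: insert_commute)
      ultimately show "e \<in> (crossing_pairs E A p \<union> crossing_pairs E B q) \<union> (A \<times> X \<union> X \<times> A)"
        using e by (cases "u \<in> A"; cases "v \<in> A") (auto simp: crossing_pairs_def r_def B_def)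
    qed
    then have "card (crossing_pairs E W r) \<le>
        card ((crossing_pairs E A p \<union> crossing_pairs E B q) \<union> (A \<times> X \<union> X \<times> A))"
      using fAB by (intro card_mono) (auto simp: finite_crossing_pairs)
    also have "\<dots> \<le> (card (crossing_pairs E A p) + card (crossing_pairs E B q)) +
        (card (A \<times> X) + card (X \<times> A))"
      by (intro order.trans[OF card_Un_le] add_mono card_Un_le)
    also have "card (A \<times> X) + card (X \<times> A) = 2 * (card A * card X)"
      by (simp add: card_cartesian_product)
    also have "card A * card X \<le> card A * k" using AX(5) by simp
    finally have c: "card (crossing_pairs E W r) \<le>
        (card (crossing_pairs E A p) + card (crossing_pairs E B q)) + 2 * (card A * k)" by simp
    \<comment> \<open>The quadratic bound absorbs the cut because the larger side has order at least \<open>s / 2\<close>.\<close>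
    have "s \<le> 2 * card B" using sW W AX(6) by simp
    then have sA: "(2 * card A * k) * s \<le> (2 * card A * k) * (2 * card B)" by (rule mult_le_mono2)
    have "s * card (crossing_pairs E W r) \<le> s * card (crossing_pairs E A p) +
        s * card (crossing_pairs E B q) + (2 * card A * k) * s"
      using mult_le_mono2[OF c, of s] by (simp add: algebra_simps)
    also have "\<dots> \<le> 2 * k * (card A)\<^sup>2 + 2 * k * (card B)\<^sup>2 + (2 * card A * k) * (2 * card B)"
      using p(3) q(3) sA by linarith
    also have "\<dots> = 2 * k * (card W)\<^sup>2" unfolding W by (simp add: power2_eq_square algebra_simps)
    finally show ?thesis using rW cl by blast
  qed
qed

section \<open>A union bound for maps\<close>

text \<open>An event that for each choice of the other coordinates is caused by at most \<open>s\<close> values of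
  one coordinate has probability at most \<open>s / card V\<close> for a uniformly random map.\<close>

lemma map_avoiding_rare_events:
  fixes bad :: "'i \<Rightarrow> ('b \<Rightarrow> 'a) \<Rightarrow> bool"
  assumes T: "finite T" and V: "finite V" and I: "finite I" and j: "\<And>i. i \<in> I \<Longrightarrow> j i \<in> T"
    and rare: "\<And>i \<psi>. i \<in> I \<Longrightarrow> \<psi> \<in> (T - {j i}) \<rightarrow>\<^sub>E V \<Longrightarrow>
      card {x \<in> V. bad i (\<psi>(j i := x))} \<le> s"
    and few: "card I * s < card V"
  obtains \<phi> where "\<phi> \<in> T \<rightarrow>\<^sub>E V" "\<And>i. i \<in> I \<Longrightarrow> \<not> bad i \<phi>"
proof -
  define Bad where "Bad i = {\<phi> \<in> T \<rightarrow>\<^sub>E V. bad i \<phi>}" for i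
  have Vpos: "card V > 0" using few by simp
  have finBad: "finite (Bad i)" for i
    using finite_PiE[OF T, of "\<lambda>_. V"] V by (simp add: Bad_def)
  have one: "card (Bad i) * card V \<le> s * card V ^ card T" if i: "i \<in> I" for i
  proof -
    let ?P = "SIGMA \<psi> : ((T - {j i}) \<rightarrow>\<^sub>E V). {x \<in> V. bad i (\<psi>(j i := x))}"
    have finP: "finite ((T - {j i}) \<rightarrow>\<^sub>E V)" using T V by (auto intro: finite_PiE)
    have "Bad i \<subseteq> (\<lambda>(\<psi>, x). \<psi>(j i := x)) ` ?P"
    proof
      fix \<phi> assume \<phi>: "\<phi> \<in> Bad i"
      let ?\<psi> = "\<phi>(j i := undefined)"
      have "?\<psi> \<in> (T - {j i}) \<rightarrow>\<^sub>E V" using \<phi> by (auto simp: Bad_def PiE_iff extensional_def)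
      moreover have "\<phi> (j i) \<in> V" using \<phi> j[OF i] by (auto simp: Bad_def)
      ultimately have "(?\<psi>, \<phi> (j i)) \<in> ?P" using \<phi> by (simp add: Bad_def)
      then show "\<phi> \<in> (\<lambda>(\<psi>, x). \<psi>(j i := x)) ` ?P" 
        by (intro image_eqI[of _ _ "(?\<psi>, \<phi> (j i))"]) simp_all
    qed
    then have "card (Bad i) \<le> card ?P"
      using finP V by (intro surj_card_le) auto
    also have "\<dots> = (\<Sum>\<psi>\<in>(T - {j i}) \<rightarrow>\<^sub>E V. card {x \<in> V. bad i (\<psi>(j i := x))})"
      using finP V by (intro card_SigmaI) auto
    also have "\<dots> \<le> (\<Sum>\<psi>\<in>(T - {j i}) \<rightarrow>\<^sub>E V. s)" using rare[OF i] by (rule sum_mono)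
    also have "\<dots> = card V ^ (card T - 1) * s" using T j[OF i] by (simp add: card_PiE)
    finally have "card (Bad i) * card V \<le> s * (card V * card V ^ (card T - 1))"
      by (simp add: mult.commute mult.left_commute)
    moreover have "card V * card V ^ (card T - 1) = card V ^ card T"
      using T j[OF i] by (metis card_gt_0_iff empty_iff power_eq_if nat_neq_iff)
    ultimately show ?thesis by metis
  qed
  have "card (\<Union>i\<in>I. Bad i) * card V \<le> (\<Sum>i\<in>I. card (Bad i)) * card V"
    by (rule mult_le_mono1) (rule card_UN_le[OF I])
  also have "\<dots> \<le> (\<Sum>i\<in>I. s * card V ^ card T)"
    unfolding sum_distrib_right by (rule sum_mono) (rule one)
  also have "\<dots> = (card I * s) * card V ^ card T" by simp
  also have "\<dots> < card V * card V ^ card T" using few Vpos by simp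
  finally have "card (\<Union>i\<in>I. Bad i) < card (T \<rightarrow>\<^sub>E V)"
    using T by (simp add: card_PiE mult.commute)
  then have "\<not> (T \<rightarrow>\<^sub>E V) \<subseteq> (\<Union>i\<in>I. Bad i)"
    using card_mono[of "\<Union>i\<in>I. Bad i"] I finBad by (metis finite_UN leD)
  then show thesis using that by (auto simp: Bad_def)
qed

section \<open>Rainbow copies of an arbitrary graph\<close>

lemma rainbow_copy_from_map:
  assumes F: "simple_graph F" and inj: "inj_on \<phi> (verts F)" and V: "\<phi> ` verts F \<subseteq> {1..n}"
    and rb: "inj_on (\<lambda>e. col (\<phi> ` e)) (edges F)"
  shows "\<not> rainbow_free n col F"
proof -
  define S where "S = Graph (\<phi> ` verts F) ((`) \<phi> ` edges F)"
  have e: "e \<subseteq> verts F" "card (\<phi> ` e) = 2" if "e \<in> edges F" for e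
  proof -
    show "e \<subseteq> verts F" using F that by (auto simp: simple_graph_def)
    then show "card (\<phi> ` e) = 2"
      using F that inj by (metis card_image inj_on_subset simple_graph_def)
  qed
  have "subgraph_of S (complete_graph n)"
    unfolding subgraph_of_def simple_graph_def
  proof (intro conjI ballI)
    show "finite (verts S)" using F by (simp add: S_def simple_graph_def)
    show "verts S \<subseteq> verts (complete_graph n)" using V by (simp add: S_def complete_graph_def)
    show "edges S \<subseteq> edges (complete_graph n)"
    proof
      fix x assume "x \<in> edges S"
      then obtain a where a: "a \<in> edges F" "x = \<phi> ` a" by (auto simp: S_def)
      then have "x \<subseteq> {1..n}" using e(1) V by blast
      then show "x \<in> edges (complete_graph n)" using e(2) a by (simp add: complete_graph_def)
    qed
    show "x \<subseteq> verts S" "card x = 2" if "x \<in> edges S" for x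
      using e that by (auto simp: S_def)
  qed
  moreover have "isomorphic_graphs S F"
    unfolding isomorphic_graphs_def
  proof (intro exI conjI)
    show "bij_betw (the_inv_into (verts F) \<phi>) (verts S) (verts F)"
      using inj by (simp add: S_def bij_betw_the_inv_into bij_betw_imageI)
    have "the_inv_into (verts F) \<phi> ` \<phi> ` a = a" if "a \<in> edges F" for a
      using e(1)[OF that] inj by (simp add: the_inv_into_f_f image_image subset_iff cong: image_cong)
    then show "edges F = (`) (the_inv_into (verts F) \<phi>) ` edges S"
      by (simp add: S_def image_image)
  qed
  moreover have "rainbow col S"
    using rb by (auto simp: rainbow_def S_def inj_on_def)
  ultimately show ?thesis unfolding rainbow_free_def by blast
qed

text \<open>
  Think of the fibres of \<open>p i\<close> as the pieces into which color \<open>i\<close> was cut. The event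
  for \<open>(a, b, d, e)\<close> excludes that the edge \<open>de\<close> was discarded or has its ends in one
  piece for the color of \<open>ab\<close>. If \<open>de\<close> has the same color as \<open>ab\<close>, one of the two
  must happen. As \<open>e\<close> differs from \<open>a\<close>, \<open>b\<close> and \<open>d\<close>, the images of
  the latter decide which images of \<open>e\<close> are bad.
\<close>

lemma rainbow_copy_from_partitions:
  fixes F :: "'a graph" and col :: "nat set \<Rightarrow> nat" and p :: "nat \<Rightarrow> nat \<Rightarrow> 'b"
  assumes F: "simple_graph F" and V: "V \<subseteq> {1..n}"
    and cl: "\<And>i u. u \<in> V \<Longrightarrow> card {v \<in> V. p i v = p i u} \<le> s"
    and deg: "\<And>u. u \<in> V \<Longrightarrow> card {v \<in> V. p (col {u, v}) u \<noteq> p (col {u, v}) v} \<le> s"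
    and large: "graph_order F ^ 4 * (2 * s) < card V"
  shows "\<not> rainbow_free n col F"
proof -
  define T where "T = verts F"
  have finT: "finite T" using F by (simp add: T_def simple_graph_def)
  have finV: "finite V" using V finite_subset by blast
  define I where "I = {(a, b, d, e). a \<in> T \<and> b \<in> T \<and> d \<in> T \<and> e \<in> T \<and> e \<notin> {a, b, d}}"
  define bad where "bad = (\<lambda>(a, b, d, e) (\<phi> :: 'a \<Rightarrow> nat).
    p (col {\<phi> a, \<phi> b}) (\<phi> e) = p (col {\<phi> a, \<phi> b}) (\<phi> d) \<or>
    p (col {\<phi> d, \<phi> e}) (\<phi> d) \<noteq> p (col {\<phi> d, \<phi> e}) (\<phi> e))"
  define j where "j = (\<lambda>(a :: 'a, b :: 'a, d :: 'a, e :: 'a). e)"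
  have I: "I \<subseteq> T \<times> T \<times> T \<times> T" by (auto simp: I_def)
  then have finI: "finite I" using finT by (auto intro: finite_subset)
  have "card I \<le> card (T \<times> T \<times> T \<times> T)" using I finT by (intro card_mono) auto
  also have "\<dots> = graph_order F ^ 4"
    by (simp add: T_def graph_order_def card_cartesian_product power4_eq_xxxx)
  finally have "card I * (2 * s) \<le> graph_order F ^ 4 * (2 * s)" by (rule mult_le_mono1)
  then have few: "card I * (2 * s) < card V" using large by (rule le_less_trans)
  have rare: "card {x \<in> V. bad i (\<psi>(j i := x))} \<le> 2 * s"
    if "i \<in> I" and "\<psi> \<in> (T - {j i}) \<rightarrow>\<^sub>E V" for i \<psi>
  proof -
    obtain a b d e where i: "i = (a, b, d, e)" by (metis prod_cases4)
    have ne: "e \<noteq> a" "e \<noteq> b" "e \<noteq> d" and dT: "d \<in> T" using that(1) by (auto simp: I_def i)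
    then have dV: "\<psi> d \<in> V" using that(2) by (auto simp: j_def i)
    let ?c = "col {\<psi> a, \<psi> b}"
    have "{x \<in> V. bad i (\<psi>(j i := x))} = {x \<in> V. p ?c x = p ?c (\<psi> d)} \<union>
        {x \<in> V. p (col {\<psi> d, x}) (\<psi> d) \<noteq> p (col {\<psi> d, x}) x}"
      using ne by (auto simp: bad_def j_def i)
    then have "card {x \<in> V. bad i (\<psi>(j i := x))} \<le> card {x \<in> V. p ?c x = p ?c (\<psi> d)} +
        card {x \<in> V. p (col {\<psi> d, x}) (\<psi> d) \<noteq> p (col {\<psi> d, x}) x}"
      by (simp add: card_Un_le)
    then show ?thesis using cl[OF dV, of ?c] deg[OF dV] by simp
  qed
  have "j i \<in> T" if "i \<in> I" for i using that by (auto simp: j_def I_def)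
  then obtain \<phi> where \<phi>: "\<phi> \<in> T \<rightarrow>\<^sub>E V" and good: "\<And>i. i \<in> I \<Longrightarrow> \<not> bad i \<phi>"
    using map_avoiding_rare_events[where bad = bad, OF finT finV finI _ rare few] by blast
  \<comment> \<open>The degenerate quadruple \<open>(d, d, d, e)\<close> makes the map injective.\<close>
  have inj: "inj_on \<phi> T"
  proof (rule inj_onI, rule ccontr)
    fix d e assume "d \<in> T" "e \<in> T" "\<phi> d = \<phi> e" "d \<noteq> e"
    then show False using good[of "(d, d, d, e)"] by (auto simp: I_def bad_def)
  qed
  have key: "col {\<phi> a, \<phi> b} \<noteq> col {\<phi> d, \<phi> e}"
    if "a \<in> T" "b \<in> T" "d \<in> T" "e \<in> T" "e \<notin> {a, b, d}" for a b d e
    using good[of "(a, b, d, e)"] that by (auto simp: I_def bad_def)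
  have "inj_on (\<lambda>e. col (\<phi> ` e)) (edges F)"
  proof (rule inj_onI, rule ccontr)
    fix e1 e2 assume e: "e1 \<in> edges F" "e2 \<in> edges F" "col (\<phi> ` e1) = col (\<phi> ` e2)" "e1 \<noteq> e2"
    then have "card e1 = 2" "card e2 = 2" and sub: "e1 \<subseteq> T" "e2 \<subseteq> T"
      using F by (auto simp: simple_graph_def T_def)
    then obtain a b d g where ab: "e1 = {a, b}" and dg: "e2 = {d, g}" "d \<noteq> g"
      by (metis card_2_iff)
    from ab dg e(4) \<open>card e1 = 2\<close> have "d \<notin> {a, b} \<or> g \<notin> {a, b}" by auto
    then show False
      using key[of a b d g] key[of a b g d] sub e(3) ab dg by (auto simp: insert_commute)
  qed
  then show ?thesis
    using rainbow_copy_from_map[OF F] inj \<phi> V by (force simp: T_def)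
qed

section \<open>The linear bound\<close>

theorem linear_highly_connected_subgraph_if_rainbow_free:
  fixes F :: "'b graph"
  assumes F: "simple_graph F"
  shows "\<exists>c::real. c > 0 \<and>
    (\<forall>m\<ge>1. \<forall>k\<ge>1. \<exists>n0. \<forall>n\<ge>n0. \<forall>col.
      coloring_using_all n m col \<and> rainbow_free n col F \<longrightarrow>
      (\<exists>S. subgraph_of S (complete_graph n) \<and> monochromatic col S \<and>
           k_connected k S \<and> real (graph_order S) \<ge> c * real n))"
proof -
  define t where "t = graph_order F"
  \<comment> \<open>The union bound needs \<open>2 s t^4\<close> to be less than the number of usable vertices. With
    \<open>s\<close> about \<open>n / D\<close> it is about \<open>n / 4\<close>; the summand 1 covers the empty graph.\<close>
  define D where "D = 8 * t ^ 4 + 1"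
  \<comment> \<open>In the bound on \<open>n\<close>, \<open>k * D\<close> ensures \<open>k < s\<close>, \<open>4 * t ^ 4\<close> pays for
    rounding \<open>s\<close>, and the term with \<open>m\<close> is twice the bound on the number of exceptional
    vertices.\<close>
  have main: "\<exists>S. subgraph_of S (complete_graph n) \<and> monochromatic col S \<and>
      k_connected k S \<and> real (graph_order S) \<ge> 1 / real D * real n"
    if n: "n \<ge> k * D + 4 * t ^ 4 + 4 * m * k * D\<^sup>2 + 1" and use_all: "coloring_using_all n m col"
      and rf: "rainbow_free n col F" for m k n and col :: "nat set \<Rightarrow> nat"
  proof (rule ccontr)
    assume none: "\<not> ?thesis"
    define s where "s = n div D + 1"
    define E where "E i = {e \<in> edges (complete_graph n). col e = i}" for i
    define N where "N = {1..n}"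
    have D: "D > 0" by (simp add: D_def)
    have sD: "n \<le> s * D" unfolding s_def
      by (metis D Suc_eq_plus1 dividend_less_div_times less_or_eq_imp_le mult.commute mult_Suc)
    have "k * D \<le> n" using n by simp
    then have "k \<le> n div D" using D by (simp add: less_eq_div_iff_mult_less_eq)
    then have ks: "k < s" by (simp add: s_def)
    have "\<exists>p. p ` N \<subseteq> N \<and> (\<forall>u\<in>N. card {v \<in> N. p v = p u} < s) \<and>
        s * card (crossing_pairs (E i) N p) \<le> 2 * k * (card N)\<^sup>2" for i
    proof (rule low_cut_partition[OF _ ks])
      show "finite N" by (simp add: N_def)
      fix U assume U: "U \<subseteq> N" "s \<le> card U"
      have "finite U" using U by (auto simp: N_def intro: finite_subset)
      then have "subgraph_of (induced (E i) U) (complete_graph n)"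
        using U by (auto simp: subgraph_of_def induced_def E_def complete_graph_def simple_graph_def N_def)
      moreover have "monochromatic col (induced (E i) U)"
        by (auto simp: monochromatic_def induced_def E_def)
      moreover have "n \<le> card U * D" using sD U(2) by (meson le_trans mult_le_mono1)
      then have "real n \<le> real (card U) * real D" by (metis of_nat_le_iff of_nat_mult)
      then have "real (graph_order (induced (E i) U)) \<ge> 1 / real D * real n"
        using D by (simp add: induced_def graph_order_def field_simps)
      ultimately show "\<not> k_connected k (induced (E i) U)" using none by blast
    qed
    then have "\<forall>i. \<exists>p. p ` N \<subseteq> N \<and> (\<forall>u\<in>N. card {v \<in> N. p v = p u} < s) \<and>
        s * card (crossing_pairs (E i) N p) \<le> 2 * k * (card N)\<^sup>2" by blast
    from choice[OF this] obtain p :: "nat \<Rightarrow> nat \<Rightarrow> nat"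
      where cl: "\<And>i u. u \<in> N \<Longrightarrow> card {v \<in> N. p i v = p i u} < s"
      and cr: "\<And>i. s * card (crossing_pairs (E i) N (p i)) \<le> 2 * k * (card N)\<^sup>2"
      by blast
    define C where "C u = {v \<in> N. p (col {u, v}) u \<noteq> p (col {u, v}) v}" for u
    have finC: "finite (C u)" for u by (simp add: C_def N_def)
    have "Sigma N C \<subseteq> (\<Union>i\<in>{1..m}. crossing_pairs (E i) N (p i))"
    proof
      fix x assume "x \<in> Sigma N C"
      then obtain u v where x: "x = (u, v)" "u \<in> N" "v \<in> N"
        "p (col {u, v}) u \<noteq> p (col {u, v}) v" by (auto simp: C_def)
      then have "u \<noteq> v" by auto
      then have e: "{u, v} \<in> edges (complete_graph n)"
        using x by (auto simp: complete_graph_def N_def)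
      then have "col {u, v} \<in> {1..m}" using use_all by (auto simp: coloring_using_all_def)
      then show "x \<in> (\<Union>i\<in>{1..m}. crossing_pairs (E i) N (p i))"
        using x e by (auto simp: crossing_pairs_def E_def)
    qed
    then have "card (Sigma N C) \<le> card (\<Union>i\<in>{1..m}. crossing_pairs (E i) N (p i))"
      by (intro card_mono) (auto simp: finite_crossing_pairs N_def)
    also have "\<dots> \<le> (\<Sum>i\<in>{1..m}. card (crossing_pairs (E i) N (p i)))" by (rule card_UN_le) simp
    finally have "s * card (Sigma N C) \<le> (\<Sum>i\<in>{1..m}. s * card (crossing_pairs (E i) N (p i)))"
      unfolding sum_distrib_left[symmetric] by (rule mult_le_mono2)
    also have "\<dots> \<le> (\<Sum>i\<in>{1..m}. 2 * k * n\<^sup>2)"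
      using cr by (intro sum_mono) (simp add: N_def)
    finally have cross: "s * card (Sigma N C) \<le> 2 * m * k * n\<^sup>2" by (simp add: mult.assoc)
    \<comment> \<open>The number of vertices with many discarded edges is bounded independently of \<open>n\<close>, since
      \<open>s\<close> is linear in \<open>n\<close>.\<close>
    define B where "B = {u \<in> N. s < card (C u)}"
    have finB: "finite B" by (simp add: B_def N_def)
    have "card B * s = (\<Sum>u\<in>B. s)" by simp
    also have "\<dots> \<le> (\<Sum>u\<in>B. card (C u))" by (rule sum_mono) (simp add: B_def)
    also have "\<dots> \<le> (\<Sum>u\<in>N. card (C u))" by (rule sum_mono2) (auto simp: B_def N_def)
    also have "\<dots> = card (Sigma N C)" using finC by (subst card_SigmaI) (auto simp: N_def)
    finally have Bs: "card B * s \<le> card (Sigma N C)" .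
    have "card B * n\<^sup>2 \<le> card B * (s * D)\<^sup>2" using sD by (simp add: power_mono)
    also have "\<dots> = s * (card B * s) * D\<^sup>2" by (simp add: power2_eq_square algebra_simps)
    also have "\<dots> \<le> s * card (Sigma N C) * D\<^sup>2" using Bs by simp
    also have "\<dots> \<le> 2 * m * k * n\<^sup>2 * D\<^sup>2" using cross by (rule mult_le_mono1)
    finally have "card B * n\<^sup>2 \<le> (2 * m * k * D\<^sup>2) * n\<^sup>2" by (simp add: mult_ac)
    moreover have "n\<^sup>2 > 0" using n by simp
    ultimately have B: "card B \<le> 2 * m * k * D\<^sup>2" by (metis mult_le_cancel2)
    have "B \<subseteq> N" by (auto simp: B_def)
    then have "card (N - B) = n - card B"
      using card_Diff_subset[OF finB] by (simp add: N_def)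
    moreover have "8 * t ^ 4 * (n div D) \<le> n"
    proof -
      have "8 * t ^ 4 * (n div D) \<le> D * (n div D)" by (simp add: D_def)
      also have "\<dots> \<le> n" by simp
      finally show ?thesis .
    qed
    moreover have "t ^ 4 * (2 * s) = 2 * (t ^ 4 * (n div D)) + 2 * t ^ 4"
      by (simp add: s_def algebra_simps)
    ultimately have large: "t ^ 4 * (2 * s) < card (N - B)" using n B by linarith
    have "\<not> rainbow_free n col F"
    proof (rule rainbow_copy_from_partitions[OF F, where V = "N - B" and p = p and s = s])
      show "N - B \<subseteq> {1..n}" by (auto simp: N_def)
      show "card {v \<in> N - B. p i v = p i u} \<le> s" if "u \<in> N - B" for i u
      proof -
        have "card {v \<in> N - B. p i v = p i u} \<le> card {v \<in> N. p i v = p i u}"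
          by (intro card_mono) (auto simp: N_def)
        then show ?thesis using cl[of u i] that by simp
      qed
      show "card {v \<in> N - B. p (col {u, v}) u \<noteq> p (col {u, v}) v} \<le> s" if "u \<in> N - B" for u
      proof -
        have "card {v \<in> N - B. p (col {u, v}) u \<noteq> p (col {u, v}) v} \<le> card (C u)"
          using finC by (intro card_mono) (auto simp: C_def)
        moreover have "card (C u) \<le> s" using that by (auto simp: B_def)
        ultimately show ?thesis by (rule order.trans)
      qed
      show "graph_order F ^ 4 * (2 * s) < card (N - B)" using large by (simp add: t_def)
    qed
    then show False using rf by contradiction
  qed
  show ?thesis
  proof (intro exI[of _ "1 / real D"] conjI allI impI)
    have "D > 0" by (simp add: D_def)
    then show "1 / real D > 0" by simp
    fix m k :: nat
    show "\<exists>n0. \<forall>n\<ge>n0. \<forall>col. coloring_using_all n m col \<and> rainbow_free n col F \<longrightarrow>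
      (\<exists>S. subgraph_of S (complete_graph n) \<and> monochromatic col S \<and>
           k_connected k S \<and> real (graph_order S) \<ge> 1 / real D * real n)"
      using main by blast
  qed
qed

lemma simple_graph_path_graph: "simple_graph (path_graph n)"
  by (auto simp: simple_graph_def path_graph_def)

lemma simple_graph_disjoint_union:
  assumes "simple_graph G" "simple_graph H"
  shows "simple_graph (disjoint_union G H)"
  using assms by (auto simp: simple_graph_def disjoint_union_def card_image)

theorem theorem1p7:
  fixes H :: "'a graph"
  assumes "H \<in> connected_good_graphs \<union> disconnected_good_graphs"
  shows "\<exists>c::real. c > 0 \<and>
    (\<forall>m\<ge>1. \<forall>k\<ge>1. \<exists>n0. \<forall>n\<ge>n0. \<forall>col.
      coloring_using_all n m col \<and> rainbow_free n col (disjoint_union (path_graph 3) H) \<longrightarrow>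
      (\<exists>S. subgraph_of S (complete_graph n) \<and> monochromatic col S \<and>
           k_connected k S \<and> real (graph_order S) \<ge> c * real n))"
proof -
  have "simple_graph H"
    using assms by (auto simp: connected_good_graphs_def disconnected_good_graphs_def good_graph_def)
  then show ?thesis
    by (intro linear_highly_connected_subgraph_if_rainbow_free simple_graph_disjoint_union
        simple_graph_path_graph)
qed

end
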